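(* If $\alpha$ is a positive rational number, then every optimal factorization of $\alpha$ is primitive.
   Context: For a nonzero algebraic number $\beta$ with minimal polynomial $c\prod_j(x-\beta_j)$ over $\mathbb Z$ (with $c>0$ and primitive coefficients), its logarithmic Mahler measure is $m(\beta)=\log c+\sum_j\log\max\{1,|\beta_j|\}$; for a positive rational $a/b$ in lowest terms, $m(a/b)=\log\max\{a,b\}$. For $t>0$, the $t$-metric Mahler measure is $m_t(\beta)=\inf\{(\sum_{n=1}^M m(\beta_n)^t)^{1/t}: M\in\mathbb N,\ \beta_n\in\overline{\mathbb Q}^\times,\ \beta=\prod_{n=1}^M\beta_n\}$. A factorization of a positive rational $\beta$ is a sequence $(a_1/b_1,a_2/b_2,\dots)$ with $a_i,b_i$ positive integers, $a_i=b_i=1$ for all but finitely many $i$, $\prod_i a_i/b_i=\beta$, $\max\{a_i,b_i\}\ge\max\{a_{i+1},b_{i+1}\}$ for all $i$, and $\gcd(a_i,b_j)=1$ for all $i,j$. It is primitive if each $\max\{a_i,b_i\}$ is prime or equal to $1$. It is optimal if there exists $T>0$ such that $m_t(\beta)=(\sum_i m(a_i/b_i)^t)^{1/t}$ for all $t\ge T$. *)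

theory Defs
  imports
    "HOL-Analysis.Analysis"
    "Berlekamp_Zassenhaus.Mahler_Measure"
begin

definition is_int_minpoly :: "complex \<Rightarrow> int poly \<Rightarrow> bool" where
  "is_int_minpoly \<beta> p \<longleftrightarrow>
     p \<noteq> 0 \<and> poly (map_poly of_int p) \<beta> = 0 \<and>
     (\<forall>q::int poly. q \<noteq> 0 \<and> poly (map_poly of_int q) \<beta> = 0 \<longrightarrow> degree p \<le> degree q) \<and>
     content p = 1 \<and> lead_coeff p > 0"

definition int_minpoly :: "complex \<Rightarrow> int poly" where
  "int_minpoly \<beta> = (THE p. is_int_minpoly \<beta> p)"

text \<open>
  Logarithmic Mahler measure of an algebraic number; \<open>log_mahler_altdef\<close> below is the usual formula
  in terms of the conjugates.
\<close>

definition log_mahler :: "complex \<Rightarrow> real" where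
  "log_mahler \<beta> = ln (mahler_measure (int_minpoly \<beta>))"

lemma ex1_int_minpoly:
  assumes "algebraic \<beta>"
  shows "\<exists>!p. is_int_minpoly \<beta> p"
proof (rule ex_ex1I)
  define R where "R = (\<lambda>q::int poly. q \<noteq> 0 \<and> poly (map_poly of_int q) \<beta> = 0)"
  obtain p where p: "\<And>i. Polynomial.coeff p i \<in> \<int>" "p \<noteq> 0" "poly p \<beta> = 0"
    using assms by (elim algebraicE) auto
  define p' where "p' = map_poly (\<lambda>z. \<lfloor>Re z\<rfloor>) p"
  have p': "p = map_poly of_int p'"
  proof (rule poly_eqI)
    fix i
    show "Polynomial.coeff p i = Polynomial.coeff (map_poly of_int p') i"
      using p(1)[of i] by (auto simp: p'_def coeff_map_poly elim: Ints_cases)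
  qed
  have "R p'"
    using p(2,3) by (auto simp: R_def p')
  define q where "q = arg_min degree R"
  have q: "R q" and q_min: "\<And>r. R r \<Longrightarrow> degree q \<le> degree r"
    using arg_min_nat_lemma[of R p' degree, OF \<open>R p'\<close>] by (simp_all add: q_def)
  define s where "s = Polynomial.smult (sgn (lead_coeff q)) (primitive_part q)"
  have q0: "q \<noteq> 0" using q by (simp add: R_def)
  have "poly (map_poly of_int (Polynomial.smult (content q) (primitive_part q))) \<beta> = 0"
    using q unfolding R_def by (simp only: content_times_primitive_part)
  hence root: "poly (map_poly of_int (primitive_part q)) \<beta> = 0"
    using q0 by (simp add: of_int_hom.map_poly_hom_smult del: content_times_primitive_part)
  define l where "l = lead_coeff (primitive_part q)"
  have "l \<noteq> 0" using q0 unfolding l_def by (simp only: leading_coeff_0_iff primitive_part_eq_0_iff not_False_eq_True)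
  have "lead_coeff (Polynomial.smult (content q) (primitive_part q)) = content q * l"
    unfolding l_def by (rule lead_coeff_smult)
  hence lq: "lead_coeff q = content q * l"
    by (simp only: content_times_primitive_part)
  have "\<bar>content q\<bar> = content q"
    using normalize_content[of q] by (simp only: normalize_int_def)
  moreover have "content q \<noteq> 0"
    using q0 by simp
  ultimately have "content q > 0" by linarith
  hence sg: "sgn (lead_coeff q) = sgn l"
    unfolding lq by (simp add: sgn_mult)
  have ls: "lead_coeff s = \<bar>l\<bar>"
    unfolding s_def sg lead_coeff_smult l_def[symmetric] by (simp add: abs_sgn mult.commute)
  have sgn0: "sgn (lead_coeff q) \<noteq> 0" "\<bar>sgn (lead_coeff q)\<bar> = 1"
    using \<open>l \<noteq> 0\<close> unfolding sg by (simp_all add: sgn_0_0 abs_sgn_eq)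
  have "is_int_minpoly \<beta> s"
    unfolding is_int_minpoly_def
  proof (intro conjI allI impI)
    show "s \<noteq> 0" using \<open>l \<noteq> 0\<close> ls by auto
    show "poly (map_poly of_int s) \<beta> = 0"
      using root unfolding s_def by (simp only: of_int_hom.map_poly_hom_smult poly_smult mult_zero_right)
    show "degree s \<le> degree r" if "r \<noteq> 0 \<and> poly (map_poly of_int r) \<beta> = 0" for r :: "int poly"
    proof -
      have "degree s = degree q"
        using sgn0(1) unfolding s_def by (simp only: degree_smult_eq degree_primitive_part if_False)
      thus ?thesis using q_min[of r] that by (simp add: R_def)
    qed
    show "content s = 1"
      using q0 sgn0(2) unfolding s_def by (simp only: content_smult content_primitive_part) simp
    show "lead_coeff s > 0"
      using \<open>l \<noteq> 0\<close> ls by linarith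
  qed
  thus "\<exists>p. is_int_minpoly \<beta> p" ..
next
  fix p q assume p: "is_int_minpoly \<beta> p" and q: "is_int_minpoly \<beta> q"
  have deg: "degree p = degree q"
    using p q unfolding is_int_minpoly_def by (meson antisym)
  define r where "r = Polynomial.smult (lead_coeff q) p - Polynomial.smult (lead_coeff p) q"
  have lc: "lead_coeff p > 0" "lead_coeff q > 0" and cont: "content p = 1" "content q = 1"
    using p q by (simp_all add: is_int_minpoly_def)
  have r_root: "poly (map_poly of_int r) \<beta> = 0"
    using p q by (simp add: is_int_minpoly_def r_def of_int_hom.map_poly_hom_smult
        of_int_poly_hom.hom_minus)
  have "r = 0"
  proof (rule ccontr)
    assume "r \<noteq> 0"
    hence "degree p \<le> degree r"
      using p r_root by (simp add: is_int_minpoly_def)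
    moreover have "degree r \<le> degree p"
      unfolding r_def by (intro degree_diff_le) (auto simp: deg)
    moreover have "Polynomial.coeff r (degree p) = 0"
      by (simp add: r_def deg)
    ultimately show False
      using \<open>r \<noteq> 0\<close> by (metis antisym leading_coeff_0_iff)
  qed
  hence eq: "Polynomial.smult (lead_coeff q) p = Polynomial.smult (lead_coeff p) q"
    by (simp add: r_def)
  hence "content (Polynomial.smult (lead_coeff q) p) = content (Polynomial.smult (lead_coeff p) q)"
    by simp
  hence "lead_coeff q = lead_coeff p"
    using lc cont by simp
  thus "p = q"
    using eq lc by (metis less_irrefl smult_cancel)
qed

lemma log_mahler_altdef:
  assumes "algebraic \<beta>"
  defines "p \<equiv> int_minpoly \<beta>"
  shows "log_mahler \<beta> = ln (of_int (lead_coeff p)) +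
           (\<Sum>x\<in>#proots (map_poly of_int p). ln (max 1 (cmod x)))"
proof -
  define P where "P = map_poly complex_of_int p"
  have "is_int_minpoly \<beta> p"
    unfolding p_def int_minpoly_def by (rule theI'[OF ex1_int_minpoly[OF assms(1)]])
  hence lc: "lead_coeff p > 0" by (simp add: is_int_minpoly_def)
  have "P \<noteq> 0" using lc by (auto simp: P_def)
  have "proots P = proots (\<Prod>x\<leftarrow>complex_roots_complex P. [:- x, 1:])"
    using \<open>P \<noteq> 0\<close> by (subst complex_roots(1)[symmetric]) (simp del: complex_roots)
  also have "\<dots> = mset (complex_roots_complex P)"
  proof -
    have "proots (\<Prod>x\<leftarrow>xs. [:- x, 1:]) = mset xs" for xs :: "complex list"
    proof (induction xs)
      case (Cons x xs)
      have "(\<Prod>x\<leftarrow>xs. [:- x, 1:]) \<noteq> 0" by (auto simp: prod_list_zero_iff)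
      hence "proots ([:- x, 1:] * (\<Prod>x\<leftarrow>xs. [:- x, 1:])) = proots [:- x, 1:] + mset xs"
        using Cons.IH by (subst proots_mult) auto
      moreover have "proots [:- x, 1:] = {#x#}"
        using proots_linear_factor[of "- x"] by (simp only: minus_minus)
      ultimately show ?case
        by (simp only: list.map prod_list.Cons mset.simps) (metis add_mset_add_single add.commute)
    qed simp
    thus ?thesis .
  qed
  finally have roots: "proots P = mset (complex_roots_complex P)" .
  have ln_prod: "0 < (\<Prod>x\<leftarrow>xs. max 1 (cmod x)) \<and>
      ln (\<Prod>x\<leftarrow>xs. max 1 (cmod x)) = (\<Sum>x\<leftarrow>xs. ln (max 1 (cmod x)))" for xs
    by (induction xs) (auto simp: ln_mult max_def)
  have "mahler_measure p = of_int (lead_coeff p) * (\<Prod>x\<leftarrow>complex_roots_complex P. max 1 (cmod x))"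
    using lc by (simp add: mahler_measure_def mahler_measure_poly_def P_def)
  thus ?thesis
    using lc ln_prod[of "complex_roots_complex P"] roots
    by (simp add: log_mahler_def p_def[symmetric] P_def[symmetric] ln_mult_pos sum_mset_sum_list flip: mset_map)
qed

text \<open>
  Only meaningful for \<open>t > 0\<close> and algebraic \<open>\<beta> \<noteq> 0\<close>, where the set below is nonempty and bounded from
  below. As \<open>0 powr t = 0\<close>, trivial summands contribute nothing.
\<close>

definition metric_mahler :: "real \<Rightarrow> complex \<Rightarrow> real" where
  "metric_mahler t \<beta> =
     Inf {(\<Sum>n=1..M. log_mahler (\<gamma> n) powr t) powr (1 / t) | (M::nat) \<gamma>.
            1 \<le> M \<and> (\<forall>n\<in>{1..M}. algebraic (\<gamma> n) \<and> \<gamma> n \<noteq> 0) \<and> \<beta> = (\<Prod>n=1..M. \<gamma> n)}"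

text \<open>
  A sequence \<open>a\<^sub>i / b\<^sub>i\<close> is given by its numerators \<open>a\<close> and denominators \<open>b\<close>, indexed
  from 0. Each fraction is in lowest terms by the last condition of \<open>is_factorization\<close>. Both the
  infinite product below and the infinite sum in \<open>is_optimal\<close> have finite support.
\<close>

definition is_factorization :: "rat \<Rightarrow> (nat \<Rightarrow> nat) \<Rightarrow> (nat \<Rightarrow> nat) \<Rightarrow> bool" where
  "is_factorization \<alpha> a b \<longleftrightarrow>
     (\<forall>i. a i > 0 \<and> b i > 0) \<and>
     finite {i. \<not> (a i = 1 \<and> b i = 1)} \<and>
     (\<Prod>i. real (a i) / real (b i)) = of_rat \<alpha> \<and>
     (\<forall>i. max (a i) (b i) \<ge> max (a (Suc i)) (b (Suc i))) \<and>
     (\<forall>i j. gcd (a i) (b j) = 1)"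

definition is_primitive :: "(nat \<Rightarrow> nat) \<Rightarrow> (nat \<Rightarrow> nat) \<Rightarrow> bool" where
  "is_primitive a b \<longleftrightarrow> (\<forall>i. prime (max (a i) (b i)) \<or> max (a i) (b i) = 1)"

definition is_optimal :: "rat \<Rightarrow> (nat \<Rightarrow> nat) \<Rightarrow> (nat \<Rightarrow> nat) \<Rightarrow> bool" where
  "is_optimal \<alpha> a b \<longleftrightarrow>
     (\<exists>T>0. \<forall>t\<ge>T. metric_mahler t (of_rat \<alpha>) =
        (\<Sum>i. log_mahler (of_nat (a i) / of_nat (b i)) powr t) powr (1 / t))"

end

theory Submission
  imports Defs "HOL-Real_Asymp.Real_Asymp"
begin

text \<open>
  If \<open>max a\<^sub>k b\<^sub>k\<close> is composite, say \<open>a\<^sub>k = p q > b\<^sub>k\<close>, replace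
  the factor \<open>a\<^sub>k / b\<^sub>k\<close> by the three factors \<open>p\<close>, \<open>q\<close>,
  \<open>1 / b\<^sub>k\<close>. Each of them has measure strictly below \<open>log a\<^sub>k\<close>, so for
  large \<open>t\<close> the sum of the \<open>t\<close>-th powers of their measures is below
  \<open>(log a\<^sub>k)\<^sup>t\<close>, contradicting optimality.
\<close>

lemma is_int_minpoly_of_nat_divide:
  assumes "coprime a b" "b > 0"
  shows "is_int_minpoly (of_nat a / of_nat b) [:- int a, int b:]"
  unfolding is_int_minpoly_def
proof (intro conjI allI impI)
  show "degree [:- int a, int b:] \<le> degree q"
    if "q \<noteq> 0 \<and> poly (map_poly of_int q) (of_nat a / of_nat b :: complex) = 0" for q
  proof -
    \<comment> \<open>A nonzero constant has no root, so degree 1 is already minimal.\<close>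
    have "degree q \<noteq> 0"
    proof
      assume "degree q = 0"
      then obtain c where "q = [:c:]" by (rule degree_eq_zeroE)
      thus False using that by auto
    qed
    thus ?thesis using assms by simp
  qed
  show "content [:- int a, int b:] = 1"
    using assms by (simp add: content_def)
qed (use assms in auto)

lemma algebraic_of_nat_divide:
  assumes "b > 0"
  shows "algebraic (of_nat a / of_nat b :: complex)"
proof (rule algebraicI)
  show "poly [:- of_nat a, of_nat b:] (of_nat a / of_nat b :: complex) = 0"
    using assms by simp
qed (use assms in \<open>auto simp: coeff_pCons split: nat.splits\<close>)

text \<open>The minimal polynomial is linear with leading coefficient \<open>b\<close> and only root
  \<open>a / b\<close>, and \<open>b * max 1 (a / b) = max a b\<close>.\<close>

lemma log_mahler_of_nat_divide:
  assumes "coprime a b" "a > 0" "b > 0"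
  shows "log_mahler (of_nat a / of_nat b) = ln (real (max a b))"
proof -
  let ?\<beta> = "of_nat a / of_nat b :: complex"
  have alg: "algebraic ?\<beta>" by (rule algebraic_of_nat_divide) fact
  have eq: "int_minpoly ?\<beta> = [:- int a, int b:]"
    unfolding int_minpoly_def
    by (rule the1_equality[OF ex1_int_minpoly[OF alg]])
       (rule is_int_minpoly_of_nat_divide[OF assms(1,3)])
  have "map_poly of_int [:- int a, int b:] = Polynomial.smult (of_nat b) [:- ?\<beta>, 1:]"
    using assms by simp
  hence "proots (map_poly of_int [:- int a, int b:]) = proots [:- ?\<beta>, 1:]"
    using assms by (simp only: proots_smult of_nat_eq_0_iff)
  hence roots: "proots (map_poly of_int [:- int a, int b:]) = {#?\<beta>#}"
    using proots_linear_factor[of "- ?\<beta>"] by (simp only: minus_minus)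
  have "log_mahler ?\<beta> = ln (real b) + ln (max 1 (real a / real b))"
    using assms unfolding log_mahler_altdef[OF alg] eq roots by (simp add: norm_divide)
  also have "\<dots> = ln (real b * max 1 (real a / real b))"
    using assms by (simp add: ln_mult)
  also have "real b * max 1 (real a / real b) = real (max a b)"
    using assms by (auto simp: max_def field_simps)
  finally show ?thesis .
qed

text \<open>Only upper bounds on the infimum enter the argument. Stating them for lists lets one
  factor be replaced by several through concatenation.\<close>

lemma metric_mahler_prod_list_le:
  assumes "xs \<noteq> []" "\<And>x. x \<in> set xs \<Longrightarrow> algebraic x \<and> x \<noteq> 0"
  shows "metric_mahler t (prod_list xs) \<le> (\<Sum>x\<leftarrow>xs. log_mahler x powr t) powr (1 / t)"
  unfolding metric_mahler_def
proof (rule cInf_lower)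
  \<comment> \<open>Families in \<open>metric_mahler\<close> are indexed from 1, lists from
    0.\<close>
  let ?\<gamma> = "\<lambda>n. xs ! (n - 1)"
  have bij: "bij_betw (\<lambda>n. n - 1) {1..length xs} {0..<length xs}"
    by (rule bij_betwI[of _ _ _ Suc]) auto
  have prod: "prod_list xs = (\<Prod>n=1..length xs. ?\<gamma> n)"
    unfolding prod.list_conv_set_nth using prod.reindex_bij_betw[OF bij, of "(!) xs"] by simp
  have sum: "(\<Sum>x\<leftarrow>xs. log_mahler x powr t) = (\<Sum>n=1..length xs. log_mahler (?\<gamma> n) powr t)"
    unfolding sum.list_conv_set_nth
    using sum.reindex_bij_betw[OF bij, of "\<lambda>i. log_mahler (xs ! i) powr t"] by simp
  have "1 \<le> length xs" using assms(1) by (cases xs) auto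
  thus "(\<Sum>x\<leftarrow>xs. log_mahler x powr t) powr (1 / t) \<in>
      {(\<Sum>n=1..M. log_mahler (\<gamma> n) powr t) powr (1 / t) | (M::nat) \<gamma>.
         1 \<le> M \<and> (\<forall>n\<in>{1..M}. algebraic (\<gamma> n) \<and> \<gamma> n \<noteq> 0) \<and> prod_list xs = (\<Prod>n=1..M. \<gamma> n)}"
    using assms(2) prod sum by (intro CollectI exI[of _ "length xs"] exI[of _ ?\<gamma>]) auto
\<comment> \<open>Values of \<open>powr\<close> are nonnegative, so 0 is a lower bound of the
  set.\<close>
qed (auto intro: bdd_belowI[of _ 0])

text \<open>The larger of \<open>a\<close> and \<open>b\<close> is split as \<open>p * q\<close>,
  and the smaller becomes a factor of its own. All integers involved are then strictly below
  \<open>max a b\<close>.\<close>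

lemma composite_split_smaller_log_mahler:
  assumes "coprime a b" "a > 0" "b > 0" "\<not> prime (max a b)" "max a b \<noteq> 1"
  obtains xs where "xs \<noteq> []" "prod_list xs = of_nat a / of_nat b"
    "\<And>x. x \<in> set xs \<Longrightarrow> algebraic x \<and> x \<noteq> 0"
    "\<And>x. x \<in> set xs \<Longrightarrow> 0 \<le> log_mahler x \<and> log_mahler x < log_mahler (of_nat a / of_nat b)"
proof -
  obtain p q where pq: "max a b = p * q" "p < max a b" "q < max a b"
  proof -
    have gt: "max a b > 1" using assms(2,5) by linarith
    then obtain p where p: "p dvd max a b" "p \<noteq> 1" "p \<noteq> max a b"
      using assms(4) unfolding prime_nat_iff by blast
    then obtain q where q: "max a b = p * q" by (elim dvdE)
    with gt have "p \<noteq> 0" "q \<noteq> 0" by (metis mult_0 not_one_less_zero, metis mult_0_right not_one_less_zero)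
    with p(2,3) q have "p < p * q" "q < p * q" by auto
    thus ?thesis using that q by simp
  qed
  have target: "log_mahler (of_nat a / of_nat b) = ln (real (max a b))"
    using assms by (simp only: log_mahler_of_nat_divide)
  have pos: "p > 0" "q > 0" using pq assms(2) by (auto intro!: Nat.gr0I)
  \<comment> \<open>Equal coprime numbers are both 1, contrary to
    \<open>max a b \<noteq> 1\<close>.\<close>
  have "a \<noteq> b" using assms(1,5) by auto
  then consider "b < a" | "a < b" by linarith
  thus thesis
  proof cases
    case 1
    \<comment> \<open>Writing every entry as a quotient matches
      \<open>log_mahler_of_nat_divide\<close>. If \<open>b = 1\<close>, the last entry is trivial
      and has measure 0, which the bound \<open>0 \<le> log_mahler x\<close> admits.\<close>
    let ?xs = "[of_nat p / of_nat 1, of_nat q / of_nat 1, of_nat 1 / of_nat b :: complex]"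
    show thesis
    proof (rule that[of ?xs])
      show "algebraic x \<and> x \<noteq> 0" if "x \<in> set ?xs" for x
        using that pos assms(3) algebraic_of_nat_divide[of 1] algebraic_of_nat_divide[of b 1] by auto
      show "0 \<le> log_mahler x \<and> log_mahler x < log_mahler (of_nat a / of_nat b)"
        if "x \<in> set ?xs" for x
        unfolding target
        using that pos assms(2,3) pq(2,3) 1 log_mahler_of_nat_divide[of p 1]
          log_mahler_of_nat_divide[of q 1] log_mahler_of_nat_divide[of 1 b]
        by auto
      show "prod_list ?xs = of_nat a / of_nat b" using pq 1 by (simp add: max_def)
    qed simp
  next
    case 2
    let ?xs = "[of_nat 1 / of_nat p, of_nat 1 / of_nat q, of_nat a / of_nat 1 :: complex]"
    show thesis
    proof (rule that[of ?xs])
      show "algebraic x \<and> x \<noteq> 0" if "x \<in> set ?xs" for x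
        using that pos assms(2) algebraic_of_nat_divide[of 1] algebraic_of_nat_divide[of _ 1] by auto
      show "0 \<le> log_mahler x \<and> log_mahler x < log_mahler (of_nat a / of_nat b)"
        if "x \<in> set ?xs" for x
        unfolding target
        using that pos assms(2,3) pq(2,3) 2 log_mahler_of_nat_divide[of 1 p]
          log_mahler_of_nat_divide[of 1 q] log_mahler_of_nat_divide[of a 1]
        by auto
      show "prod_list ?xs = of_nat a / of_nat b" using pq 2 by (simp add: max_def)
    qed simp
  qed
qed

lemma powr_at_top_tendsto_0:
  fixes c :: real
  assumes "0 \<le> c" "c < 1"
  shows "((\<lambda>t. c powr t) \<longlongrightarrow> 0) at_top"
\<comment> \<open>For \<open>c = 0\<close> the convention \<open>0 powr t = 0\<close> applies;
  otherwise \<open>ln c < 0\<close> gives exponential decay.\<close>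
proof (cases "c = 0")
  case False
  with assms have "c > 0" "ln c < 0" by auto
  thus ?thesis using assms by real_asymp
qed simp

text \<open>After division by \<open>A powr t\<close>, the left side is a fixed finite sum of powers
  of ratios in [0, 1), which tends to 0 and so drops below 1.\<close>

lemma eventually_sum_list_powr_less:
  fixes ys :: "real list"
  assumes "\<And>y. y \<in> set ys \<Longrightarrow> 0 \<le> y \<and> y < A" "A > 0"
  shows "\<forall>\<^sub>F t in at_top. (\<Sum>y\<leftarrow>ys. y powr t) < A powr t"
proof -
  have "((\<lambda>t. \<Sum>y\<leftarrow>ys. (y / A) powr t) \<longlongrightarrow> 0) at_top"
    using assms(1)
  proof (induction ys)
    case (Cons y ys)
    thus ?case using \<open>A > 0\<close>
      by (auto intro!: tendsto_add_zero powr_at_top_tendsto_0)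
  qed simp
  hence "\<forall>\<^sub>F t in at_top. (\<Sum>y\<leftarrow>ys. (y / A) powr t) < 1"
    by (rule order_tendstoD) simp
  thus ?thesis
  proof eventually_elim
    case (elim t)
    have "(\<Sum>y\<leftarrow>ys. (y / A) powr t) = (\<Sum>y\<leftarrow>ys. y powr t) / A powr t"
      using assms by (induction ys) (auto simp: powr_divide add_divide_distrib)
    thus ?case using elim \<open>A > 0\<close> by simp
  qed
qed

theorem theorem2p7:
  fixes \<alpha> :: rat and a b :: "nat \<Rightarrow> nat"
  assumes "\<alpha> > 0"
    and "is_factorization \<alpha> a b"
    and "is_optimal \<alpha> a b"
  shows "is_primitive a b"
proof (rule ccontr)
  assume "\<not> is_primitive a b"
  then obtain k where k: "\<not> prime (max (a k) (b k))" "max (a k) (b k) \<noteq> 1"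
    by (auto simp: is_primitive_def)
  define S where "S = {i. \<not> (a i = 1 \<and> b i = 1)}"
  have pos: "a i > 0" "b i > 0" and cop: "coprime (a i) (b i)" for i
    using assms(2) by (auto simp: is_factorization_def coprime_iff_gcd_eq_1)
  have "finite S" and prodinf: "(\<Prod>i. real (a i) / real (b i)) = of_rat \<alpha>"
    using assms(2) by (auto simp: is_factorization_def S_def)
  have "k \<in> S" using k by (auto simp: S_def)
  define f where "f i = (of_nat (a i) / of_nat (b i) :: complex)" for i
  have f1: "f i = 1" "log_mahler (f i) = 0" if "i \<notin> S" for i
    using that log_mahler_of_nat_divide[of 1 1] by (auto simp: S_def f_def)
  have "real_of_rat \<alpha> = (\<Prod>i\<in>S. real (a i) / real (b i))"
    unfolding prodinf[symmetric] by (rule prodinf_finite) (use \<open>finite S\<close> in \<open>auto simp: S_def\<close>)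
  \<comment> \<open>The product in \<open>is_factorization\<close> is real, whereas
    \<open>metric_mahler\<close> takes a complex argument.\<close>
  hence "of_real (real_of_rat \<alpha>) = (\<Prod>i\<in>S. f i)"
    by (simp add: f_def)
  hence \<alpha>: "of_rat \<alpha> = f k * (\<Prod>i\<in>S - {k}. f i)"
    using prod.remove[OF \<open>finite S\<close> \<open>k \<in> S\<close>, of f]
    by (cases \<alpha>) (simp add: of_rat_rat)

  obtain xs where xs: "xs \<noteq> []" "prod_list xs = f k"
    "\<And>x. x \<in> set xs \<Longrightarrow> algebraic x \<and> x \<noteq> 0"
    "\<And>x. x \<in> set xs \<Longrightarrow> 0 \<le> log_mahler x \<and> log_mahler x < log_mahler (f k)"
    using composite_split_smaller_log_mahler[OF cop pos k] unfolding f_def by metis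
  \<comment> \<open>Any entry of the nonempty list \<open>xs\<close> has measure at least 0 and
    below that of \<open>f k\<close>.\<close>
  have "log_mahler (f k) > 0"
    using xs(1,4) by (cases xs) force+
  hence "\<forall>\<^sub>F t in at_top. (\<Sum>y\<leftarrow>map log_mahler xs. y powr t) < log_mahler (f k) powr t"
    using xs(4) by (intro eventually_sum_list_powr_less) auto
  moreover obtain T where T: "T > 0" "\<And>t. t \<ge> T \<Longrightarrow> metric_mahler t (of_rat \<alpha>) =
      (\<Sum>i. log_mahler (f i) powr t) powr (1 / t)"
    using assms(3) by (auto simp: is_optimal_def f_def)
  \<comment> \<open>A single exponent must satisfy both the optimality identity and the strict
    inequality.\<close>
  ultimately have "\<forall>\<^sub>F t in at_top. t \<ge> T \<and>
      (\<Sum>y\<leftarrow>map log_mahler xs. y powr t) < log_mahler (f k) powr t"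
    by (intro eventually_conj eventually_ge_at_top)
  then obtain t where t: "t \<ge> T"
    and less: "(\<Sum>x\<leftarrow>xs. log_mahler x powr t) < log_mahler (f k) powr t"
    by (auto simp: o_def dest!: eventually_happens)

  \<comment> \<open>This competitor need not be ordered as \<open>is_factorization\<close> demands,
    since \<open>metric_mahler\<close> ranges over all products of nonzero algebraic
    numbers.\<close>
  define zs where "zs = xs @ map f (sorted_list_of_set (S - {k}))"
  define R where "R = (\<Sum>i\<in>S - {k}. log_mahler (f i) powr t)"
  have "prod_list zs = of_rat \<alpha>"
    using \<open>finite S\<close> xs(2) by (simp add: zs_def \<alpha> prod.distinct_set_conv_list[symmetric])
  moreover have "(\<Sum>x\<leftarrow>zs. log_mahler x powr t) = (\<Sum>x\<leftarrow>xs. log_mahler x powr t) + R"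
    using \<open>finite S\<close>
    by (simp add: zs_def R_def o_def sum.distinct_set_conv_list[symmetric])
  moreover have "algebraic x \<and> x \<noteq> 0" if "x \<in> set zs" for x
    using that xs(3) pos \<open>finite S\<close>
    by (auto simp: zs_def f_def algebraic_of_nat_divide order_less_imp_not_eq2)
  ultimately have "metric_mahler t (of_rat \<alpha>) \<le>
      ((\<Sum>x\<leftarrow>xs. log_mahler x powr t) + R) powr (1 / t)"
    using metric_mahler_prod_list_le[of zs t] xs(1) by (auto simp: zs_def)
  also have "\<dots> < (log_mahler (f k) powr t + R) powr (1 / t)"
  proof (rule powr_less_mono2)
    show "0 \<le> (\<Sum>x\<leftarrow>xs. log_mahler x powr t) + R"
      unfolding R_def by (intro add_nonneg_nonneg sum_list_nonneg sum_nonneg) auto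
  qed (use less t T(1) in auto)
  also have "log_mahler (f k) powr t + R = (\<Sum>i\<in>S. log_mahler (f i) powr t)"
    unfolding R_def using sum.remove[OF \<open>finite S\<close> \<open>k \<in> S\<close>] by metis
  \<comment> \<open>Outside \<open>S\<close> each measure is 0, and
    \<open>0 powr t = 0\<close>.\<close>
  also have "\<dots> = (\<Sum>i. log_mahler (f i) powr t)"
    by (rule suminf_finite[symmetric]) (use \<open>finite S\<close> f1 in auto)
  finally show False using T(2)[OF t] by simp
qed

end
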